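(* Let $B=B_1B_2\cdots B_\omega$ be a binary string with at least two symbols whose first two symbols are equal (so $|B_1|\ge 2$) and whose last block $B_\omega$ is a 1-block, and let $T=T(B)$. A set $S\subseteq V(T)$ is a power dominating set of $T$ if and only if there exists $v\in S$ such that (a) every 1-vertex lies in $N[v]$, and (b) every 0-block that is the block containing $v$ or follows it in $B$ has at most one vertex not in $S$.
   Context: For a binary string $B$, the threshold graph $T(B)$ has the symbols of $B$ as vertices, with an edge between symbols $x$ and $y$ ($x$ to the left of $y$) if and only if $y=1$. A block of $B$ is a maximal contiguous substring consisting only of 0s or only of 1s; $B=B_1\cdots B_\omega$ is the partition into blocks, a 0-block (1-block) consists of 0s (1s), and a 0-vertex (1-vertex) is a vertex lying in a 0-block (1-block). $N[v]$ is the closed neighborhood of $v$. For $S\subseteq V$, $S$ is a power dominating set if, after coloring $S$, coloring every neighbor of a vertex of $S$, and then repeatedly applying the forcing rule (a colored vertex with exactly one uncolored neighbor colors that neighbor) until no changes occur, all vertices are colored. *)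

theory Defs
  imports "Graph_Theory.Graph_Theory"
begin

text \<open>Undirected graphs are symmetric digraphs, as in the library locale \<^locale>\<open>pair_graph\<close>.\<close>

definition neighborhood :: "'a pair_pre_digraph \<Rightarrow> 'a \<Rightarrow> 'a set" where
  "neighborhood G v = {w. (v, w) \<in> parcs G}"

definition closed_neighborhood :: "'a pair_pre_digraph \<Rightarrow> 'a \<Rightarrow> 'a set" where
  "closed_neighborhood G v = insert v (neighborhood G v)"

definition force_step :: "'a pair_pre_digraph \<Rightarrow> 'a set \<Rightarrow> 'a set \<Rightarrow> bool" where
  "force_step G C C' \<longleftrightarrow>
     (\<exists>u\<in>C. \<exists>w. neighborhood G u - C = {w} \<and> C' = insert w C)"

text \<open>No forcing step applies once every vertex is colored, so a run that reaches \<open>pverts G\<close>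
  has indeed stopped. Forcing is monotone in the colored set, hence the final coloring does not
  depend on the order in which forces are carried out.\<close>

definition power_dominating_set :: "'a pair_pre_digraph \<Rightarrow> 'a set \<Rightarrow> bool" where
  "power_dominating_set G S \<longleftrightarrow>
     S \<subseteq> pverts G \<and> (force_step G)\<^sup>*\<^sup>* (S \<union> (\<Union>v\<in>S. neighborhood G v)) (pverts G)"

text \<open>A binary string is a \<^typ>\<open>bool list\<close>, with \<^term>\<open>True\<close> for the symbol 1 and \<^term>\<open>False\<close>
  for the symbol 0. The symbols of \<open>B\<close>, as distinct vertices, are represented by their positions
  \<open>0, ..., length B - 1\<close>, and a substring occurrence by its set of positions.\<close>

definition threshold_graph :: "bool list \<Rightarrow> nat pair_pre_digraph" where
  "threshold_graph B =
     \<lparr> pverts = {..<length B},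
       parcs = {(x, y). x < length B \<and> y < length B \<and> (x < y \<and> B ! y \<or> y < x \<and> B ! x)} \<rparr>"

lemma pair_graph_threshold_graph: "pair_graph (threshold_graph B)"
proof
  have "parcs (threshold_graph B) \<subseteq> {..<length B} \<times> {..<length B}"
    by (auto simp: threshold_graph_def)
  then show "finite (parcs (threshold_graph B))"
    by (rule finite_subset) simp
qed (auto simp: threshold_graph_def symmetric_def sym_def)

definition substring_positions :: "bool list \<Rightarrow> nat set \<Rightarrow> bool" where
  "substring_positions B X \<longleftrightarrow> (\<exists>i j. i < j \<and> j \<le> length B \<and> X = {i..<j})"

definition all_zeros :: "bool list \<Rightarrow> nat set \<Rightarrow> bool" where
  "all_zeros B X \<longleftrightarrow> (\<forall>k\<in>X. \<not> B ! k)"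

definition all_ones :: "bool list \<Rightarrow> nat set \<Rightarrow> bool" where
  "all_ones B X \<longleftrightarrow> (\<forall>k\<in>X. B ! k)"

definition uniform_substring :: "bool list \<Rightarrow> nat set \<Rightarrow> bool" where
  "uniform_substring B X \<longleftrightarrow> substring_positions B X \<and> (all_zeros B X \<or> all_ones B X)"

definition blocks :: "bool list \<Rightarrow> nat set set" where
  "blocks B = {X. uniform_substring B X \<and> (\<forall>Y. uniform_substring B Y \<and> X \<subseteq> Y \<longrightarrow> Y = X)}"

definition zero_blocks :: "bool list \<Rightarrow> nat set set" where
  "zero_blocks B = {X \<in> blocks B. all_zeros B X}"

definition one_blocks :: "bool list \<Rightarrow> nat set set" where
  "one_blocks B = {X \<in> blocks B. all_ones B X}"

definition one_vertices :: "bool list \<Rightarrow> nat set" where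
  "one_vertices B = \<Union> (one_blocks B)"

definition precedes :: "nat set \<Rightarrow> nat set \<Rightarrow> bool" where
  "precedes X Y \<longleftrightarrow> (\<forall>x\<in>X. \<forall>y\<in>Y. x < y)"

definition last_block :: "bool list \<Rightarrow> nat set \<Rightarrow> bool" where
  "last_block B L \<longleftrightarrow> L \<in> blocks B \<and> (\<forall>X\<in>blocks B. X \<noteq> L \<longrightarrow> precedes X L)"

end

theory Submission
  imports Defs
begin

text \<open>Two vertices with the same neighbors outside of themselves are never forced if both start
  out uncolored, because a vertex that sees one of them sees the other.  Positions 0 and 1 are such
  twins, and so are any two positions of a common 0-block.  For necessity let \<open>v\<close> be the rightmost
  1-vertex of \<open>S\<close>, or, if \<open>S\<close> has none, a vertex of \<open>S\<close> with no 1 to its left (it exists, since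
  otherwise 0 and 1 are uncolored twins); the 0-vertices in or after the block of \<open>v\<close> are initially
  colored only if they lie in \<open>S\<close>.  For sufficiency, initially all 1s are colored and any two
  uncolored positions are separated by a 1.  Hence the first 1 after the leftmost uncolored position
  \<open>p\<close> has \<open>p\<close> as its only uncolored neighbor, and the positions can be forced from left to right.\<close>

section \<open>Adjacency in threshold graphs and forcing on twins\<close>

lemma mem_neighborhood_threshold_graph:
  "w \<in> neighborhood (threshold_graph B) u \<longleftrightarrow>
     u < length B \<and> w < length B \<and> (u < w \<and> B ! w \<or> w < u \<and> B ! u)"
  by (simp add: neighborhood_def threshold_graph_def)

lemma pverts_threshold_graph: "pverts (threshold_graph B) = {..<length B}"
  by (simp add: threshold_graph_def)

lemma twins_remain_uncolored:
  assumes "(force_step G)\<^sup>*\<^sup>* C C'" and "p \<noteq> q" and "p \<notin> C" and "q \<notin> C"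
    and twins: "\<And>u. u \<noteq> p \<Longrightarrow> u \<noteq> q \<Longrightarrow> p \<in> neighborhood G u \<longleftrightarrow> q \<in> neighborhood G u"
  shows "p \<notin> C' \<and> q \<notin> C'"
  using assms(1)
proof (induction rule: rtranclp_induct)
  case base
  show ?case using assms(3,4) by simp
next
  case (step D D')
  obtain u w where u: "u \<in> D" and w: "neighborhood G u - D = {w}" and D': "D' = insert w D"
    using step.hyps(2) unfolding force_step_def by blast
  \<comment> \<open>The forcing vertex \<open>u\<close> is colored while \<open>p\<close> and
    \<open>q\<close> are not, so \<open>u\<close> is neither of them and the twin condition
    applies.\<close>
  have "p \<in> neighborhood G u \<longleftrightarrow> q \<in> neighborhood G u"
    using u step.IH twins[of u] by blast
  then have "w \<noteq> p \<and> w \<noteq> q"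
    using w step.IH \<open>p \<noteq> q\<close> by (metis DiffD1 DiffI singletonD singletonI)
  then show ?case using step.IH D' by auto
qed

section \<open>Blocks as maximal uniform intervals\<close>

lemma uniform_substring_union:
  assumes "uniform_substring B X" and "uniform_substring B Y" and "X \<inter> Y \<noteq> {}"
  shows "uniform_substring B (X \<union> Y)"
proof -
  obtain i j where ij: "i < j" "j \<le> length B" "X = {i..<j}"
    using assms(1) by (auto simp: uniform_substring_def substring_positions_def)
  obtain k l where kl: "k < l" "l \<le> length B" "Y = {k..<l}"
    using assms(2) by (auto simp: uniform_substring_def substring_positions_def)
  obtain z where z: "z \<in> X" "z \<in> Y"
    using assms(3) by blast
  have "X \<union> Y = {min i k..<max j l}"
    using z ij kl by auto
  then have "substring_positions B (X \<union> Y)"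
    unfolding substring_positions_def using ij kl
    by (intro exI[of _ "min i k"] exI[of _ "max j l"]) auto
  \<comment> \<open>The symbol at the shared position \<open>z\<close> determines both
    intervals.\<close>
  moreover have "all_zeros B (X \<union> Y) \<or> all_ones B (X \<union> Y)"
    using assms(1,2) z by (auto simp: uniform_substring_def all_zeros_def all_ones_def)
  ultimately show ?thesis by (simp add: uniform_substring_def)
qed

text \<open>Otherwise the union would be a uniform interval properly containing the block. This is
  the form in which maximality is used later.\<close>

lemma uniform_subset_block:
  assumes "X \<in> blocks B" and "uniform_substring B Y" and "X \<inter> Y \<noteq> {}"
  shows "Y \<subseteq> X"
proof -
  have "uniform_substring B (X \<union> Y)"
    using assms by (intro uniform_substring_union) (auto simp: blocks_def)
  then have "X \<union> Y = X"
    using assms(1) unfolding blocks_def by blast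
  then show ?thesis by blast
qed

lemma blocks_eqI:
  assumes "X \<in> blocks B" and "Y \<in> blocks B" and "z \<in> X" and "z \<in> Y"
  shows "X = Y"
  using uniform_subset_block[of X B Y] uniform_subset_block[of Y B X] assms
  by (auto simp: blocks_def)

lemma block_is_interval:
  assumes "X \<in> blocks B"
  obtains i j where "i < j" "j \<le> length B" "X = {i..<j}"
  using assms by (auto simp: blocks_def uniform_substring_def substring_positions_def)

text \<open>Distinct blocks are disjoint intervals, so comparing one position from each orders them
  entirely.\<close>

lemma blocks_precedesI:
  assumes "X \<in> blocks B" and "Y \<in> blocks B" and "x \<in> X" and "y \<in> Y" and "x \<le> y" and "X \<noteq> Y"
  shows "precedes X Y"
proof -
  obtain i j where X: "X = {i..<j}" using assms(1) by (rule block_is_interval)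
  obtain k l where Y: "Y = {k..<l}" using assms(2) by (rule block_is_interval)
  have "X \<inter> Y = {}" using blocks_eqI assms(1,2,6) by blast
  then have "x \<notin> Y" "k \<notin> X" using assms(3,4) Y by auto
  then have "j \<le> k"
    using assms(3-5) X Y by auto
  then show ?thesis by (auto simp: precedes_def X Y)
qed

lemma obtain_block:
  assumes "k < length B"
  obtains X where "X \<in> blocks B" "k \<in> X"
proof -
  let ?U = "{X. uniform_substring B X}"
  have "?U \<subseteq> Pow {..<length B}"
    by (auto simp: uniform_substring_def substring_positions_def)
  then have "finite ?U"
    by (rule finite_subset) simp
  moreover have "substring_positions B {k}"
    unfolding substring_positions_def using assms by (intro exI[of _ k] exI[of _ "Suc k"]) auto
  then have "{k} \<in> ?U"
    by (simp add: uniform_substring_def all_zeros_def all_ones_def)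
  ultimately obtain X where "X \<in> ?U" "{k} \<subseteq> X" "\<And>Y. Y \<in> ?U \<Longrightarrow> X \<subseteq> Y \<Longrightarrow> X = Y"
    using finite_has_maximal2[of ?U "{k}"] by blast
  then show ?thesis
    by (intro that[of X]) (auto simp: blocks_def)
qed

lemma block_subset: "X \<in> blocks B \<Longrightarrow> X \<subseteq> {..<length B}"
  by (auto elim: block_is_interval)

lemma one_vertices_eq: "one_vertices B = {k. k < length B \<and> B ! k}"
proof (intro set_eqI iffI)
  fix k assume "k \<in> one_vertices B"
  then show "k \<in> {k. k < length B \<and> B ! k}"
    using block_subset by (auto simp: one_vertices_def one_blocks_def all_ones_def)
next
  fix k assume k: "k \<in> {k. k < length B \<and> B ! k}"
  then obtain X where X: "X \<in> blocks B" "k \<in> X"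
    using obtain_block by blast
  then have "all_ones B X"
    using k by (auto simp: blocks_def uniform_substring_def all_zeros_def)
  then show "k \<in> one_vertices B"
    using X by (auto simp: one_vertices_def one_blocks_def)
qed

lemma zero_block_convex:
  assumes "X \<in> zero_blocks B" and "p \<in> X" and "q \<in> X" and "p \<le> r" and "r \<le> q"
  shows "\<not> B ! r"
proof -
  have "X \<in> blocks B" "all_zeros B X"
    using assms(1) by (auto simp: zero_blocks_def)
  then show ?thesis
    using assms(2-) by (auto simp: all_zeros_def elim!: block_is_interval)
qed

lemma zeros_in_common_block:
  assumes "p \<le> q" and "q < length B" and zeros: "\<And>r. p \<le> r \<Longrightarrow> r \<le> q \<Longrightarrow> \<not> B ! r"
  obtains X where "X \<in> zero_blocks B" "p \<in> X" "q \<in> X"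
proof -
  have "substring_positions B {p..q}"
    unfolding substring_positions_def using assms
    by (intro exI[of _ p] exI[of _ "Suc q"]) auto
  then have unif: "uniform_substring B {p..q}"
    using zeros by (simp add: uniform_substring_def all_zeros_def)
  obtain X where X: "X \<in> blocks B" "p \<in> X"
    using assms obtain_block[of p B] by auto
  have "p \<in> X \<inter> {p..q}"
    using X(2) assms(1) by simp
  then have "{p..q} \<subseteq> X"
    using uniform_subset_block[OF X(1) unif] by blast
  moreover have "\<not> B ! p"
    using assms by simp
  then have "all_zeros B X"
    using X by (auto simp: blocks_def uniform_substring_def all_ones_def)
  ultimately show ?thesis
    using that X assms(1) by (auto simp: zero_blocks_def)
qed

lemma last_symbol_if_last_block_ones:
  assumes "last_block B L" and "L \<in> one_blocks B"
  shows "B ! (length B - 1)" and "length B > 0"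
proof -
  have L: "L \<in> blocks B" "all_ones B L"
    using assms(2) by (auto simp: one_blocks_def)
  obtain i j where ij: "i < j" "j \<le> length B" "L = {i..<j}"
    using L(1) by (rule block_is_interval)
  then show "length B > 0" by linarith
  then obtain X where X: "X \<in> blocks B" "length B - 1 \<in> X"
    using obtain_block[of "length B - 1" B] by auto
  have "i \<in> L" "i \<le> length B - 1" using ij by auto
  \<comment> \<open>Otherwise \<open>X\<close> would precede \<open>L\<close>, putting the final
    position strictly left of \<open>i\<close>.\<close>
  then have "X = L"
    using assms(1) X by (fastforce simp: last_block_def precedes_def)
  then show "B ! (length B - 1)"
    using X L(2) by (simp add: all_ones_def)
qed

section \<open>Sufficiency of the criterion\<close>

text \<open>The conditions on \<open>C\<close> survive the coloring of further positions, so one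
  force suffices for an induction on the number of uncolored positions.\<close>

lemma separated_coloring_forces_all:
  assumes "C \<subseteq> {..<length B}"
    and ones: "\<And>k. k < length B \<Longrightarrow> B ! k \<Longrightarrow> k \<in> C"
    and separated: "\<And>p q. p < q \<Longrightarrow> q < length B \<Longrightarrow> p \<notin> C \<Longrightarrow> q \<notin> C \<Longrightarrow> \<exists>r. p < r \<and> r < q \<and> B ! r"
    and last: "B ! (length B - 1)" and "length B > 0"
  shows "(force_step (threshold_graph B))\<^sup>*\<^sup>* C {..<length B}"
  using assms(1-3)
proof (induction "card ({..<length B} - C)" arbitrary: C rule: less_induct)
  case less
  show ?case
  proof (cases "C = {..<length B}")
    case True
    then show ?thesis by simp
  next
    case False
    then have ex: "\<exists>p. p < length B \<and> p \<notin> C" using less.prems(1) by auto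
    define p where "p = (LEAST p. p < length B \<and> p \<notin> C)"
    have p: "p < length B" "p \<notin> C"
      using LeastI_ex[OF ex] by (auto simp: p_def)
    have p_least: "p \<le> q" if "q < length B" "q \<notin> C" for q
      using that Least_le[of "\<lambda>p. p < length B \<and> p \<notin> C" q] by (simp add: p_def)
    have "\<not> B ! p" using less.prems(2) p by blast
    then have "p \<noteq> length B - 1" using last by auto
    \<comment> \<open>The final 1 guarantees that a forcing vertex exists to the right of
      \<open>p\<close>.\<close>
    then have ex': "\<exists>r. p < r \<and> r < length B \<and> B ! r"
      using last p by (intro exI[of _ "length B - 1"]) auto
    define r where "r = (LEAST r. p < r \<and> r < length B \<and> B ! r)"
    have r: "p < r" "r < length B" "B ! r"
      using LeastI_ex[OF ex'] by (auto simp: r_def)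
    have r_least: "r \<le> s" if "p < s" "s < length B" "B ! s" for s
      using that Least_le[of "\<lambda>r. p < r \<and> r < length B \<and> B ! r" s] by (simp add: r_def)
    have "q = p" if "q \<in> neighborhood (threshold_graph B) r - C" for q
    proof (rule ccontr)
      assume "q \<noteq> p"
      \<comment> \<open>A neighbor of \<open>r\<close> to its right would be a 1, hence already
        colored.\<close>
      have q: "q < length B" "q \<notin> C" "q < r"
        using that less.prems(2) by (auto simp: mem_neighborhood_threshold_graph)
      then have "p < q" using p_least[of q] \<open>q \<noteq> p\<close> by simp
      then obtain s where "p < s" "s < q" "B ! s"
        using less.prems(3) q p by blast
      then show False using r_least[of s] q by simp
    qed
    moreover have "p \<in> neighborhood (threshold_graph B) r - C"
      using p r by (simp add: mem_neighborhood_threshold_graph)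
    ultimately have "neighborhood (threshold_graph B) r - C = {p}" by blast
    then have step: "force_step (threshold_graph B) C (insert p C)"
      unfolding force_step_def using less.prems(2) r by blast
    have "card ({..<length B} - insert p C) < card ({..<length B} - C)"
      using p by (intro psubset_card_mono) auto
    then have "(force_step (threshold_graph B))\<^sup>*\<^sup>* (insert p C) {..<length B}"
      using less.prems p by (intro less.hyps) auto
    with step show ?thesis by (rule converse_rtranclp_into_rtranclp)
  qed
qed

text \<open>Two uncolored positions with no 1 between them would lie in a 0-block \<open>X\<close>
  with two vertices outside \<open>S\<close>. The bound then forces \<open>X\<close> to lie before
  the block of \<open>v\<close>, but the domination of all 1s by \<open>v\<close> puts
  \<open>v\<close> into \<open>X\<close>.\<close>

lemma power_dominating_set_if_criterion:
  assumes S: "S \<subseteq> {..<length B}" and last: "B ! (length B - 1)" "length B > 0"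
    and v: "v \<in> S" "one_vertices B \<subseteq> closed_neighborhood (threshold_graph B) v"
    and Y: "Y \<in> blocks B" "v \<in> Y"
    and card: "\<And>X. X \<in> zero_blocks B \<Longrightarrow> X = Y \<or> precedes Y X \<Longrightarrow> card (X - S) \<le> 1"
  shows "power_dominating_set (threshold_graph B) S"
proof -
  let ?C = "S \<union> (\<Union>v\<in>S. neighborhood (threshold_graph B) v)"
  have "(force_step (threshold_graph B))\<^sup>*\<^sup>* ?C {..<length B}"
  proof (rule separated_coloring_forces_all)
    show "?C \<subseteq> {..<length B}"
      using S by (auto simp: mem_neighborhood_threshold_graph)
    show ones: "k \<in> ?C" if "k < length B" "B ! k" for k
      using that v by (auto simp: one_vertices_eq closed_neighborhood_def)
    show "\<exists>r. p < r \<and> r < q \<and> B ! r" if "p < q" "q < length B" "p \<notin> ?C" "q \<notin> ?C" for p q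
    proof (rule ccontr)
      assume none: "\<not> ?thesis"
      have "\<not> B ! p" "\<not> B ! q"
        using ones[of p] ones[of q] that by auto
      with none have "\<not> B ! r" if "p \<le> r" "r \<le> q" for r
        using that by (metis le_neq_implies_less)
      then obtain X where X: "X \<in> zero_blocks B" "p \<in> X" "q \<in> X"
        using zeros_in_common_block[of p q B] \<open>p < q\<close> \<open>q < length B\<close> by auto
      then have "finite X"
        using finite_subset[OF block_subset] by (auto simp: zero_blocks_def)
      then have "card {p, q} \<le> card (X - S)"
        using X that by (intro card_mono) auto
      then have "\<not> (X = Y \<or> precedes Y X)"
        using card[OF X(1)] \<open>p < q\<close> by auto
      then have XY: "X \<noteq> Y" "\<not> precedes Y X" by auto
      have "\<not> v \<le> p"
        using XY X Y blocks_precedesI[of Y B X v p] by (auto simp: zero_blocks_def)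
      then have "p < v" by simp
      have "v < length B" using v(1) S by auto
      \<comment> \<open>A 1 at \<open>v\<close> would have colored \<open>p\<close> at the
        start.\<close>
      then have "\<not> B ! v"
        using that v(1) \<open>p < v\<close> by (auto simp: mem_neighborhood_threshold_graph)
      have "\<not> B ! r" if "p \<le> r" "r \<le> v" for r
      proof
        assume "B ! r"
        \<comment> \<open>All neighbors of the 0-vertex \<open>v\<close> lie to its right, so a 1 at
          \<open>r\<close> could not be dominated by \<open>v\<close>.\<close>
        then have "r \<in> closed_neighborhood (threshold_graph B) v"
          using v(2) that \<open>v < length B\<close> by (auto simp: one_vertices_eq)
        then show False
          using that \<open>B ! r\<close> \<open>\<not> B ! v\<close>
          by (auto simp: closed_neighborhood_def mem_neighborhood_threshold_graph)
      qed
      then obtain Z where "Z \<in> zero_blocks B" "p \<in> Z" "v \<in> Z"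
        using zeros_in_common_block[of p v B] \<open>p < v\<close> \<open>v < length B\<close> by auto
      then have "X = Z" "Z = Y"
        using X Y blocks_eqI by (auto simp: zero_blocks_def)
      then show False using XY by simp
    qed
  qed (use last in auto)
  then show ?thesis
    using S by (simp add: power_dominating_set_def pverts_threshold_graph)
qed

section \<open>Necessity of the criterion\<close>

text \<open>Forcing cannot color the twins, so the initial step must reach one of them from
  \<open>S\<close>; that vertex of \<open>S\<close> is neither twin and hence sees both.\<close>

lemma power_dominating_set_covers_twins:
  assumes "power_dominating_set G S" and "p \<noteq> q" and "p \<in> pverts G"
    and "p \<notin> S" and "q \<notin> S"
    and "\<And>u. u \<noteq> p \<Longrightarrow> u \<noteq> q \<Longrightarrow> p \<in> neighborhood G u \<longleftrightarrow> q \<in> neighborhood G u"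
  obtains u where "u \<in> S" "p \<in> neighborhood G u" "q \<in> neighborhood G u"
proof -
  let ?C = "S \<union> (\<Union>v\<in>S. neighborhood G v)"
  have "p \<in> ?C \<or> q \<in> ?C"
    using twins_remain_uncolored[of G ?C "pverts G" p q] assms
    by (auto simp: power_dominating_set_def)
  then obtain u where "u \<in> S" "p \<in> neighborhood G u \<or> q \<in> neighborhood G u"
    using assms(4,5) by auto
  then show ?thesis using that assms(4-6) by metis
qed

text \<open>Two vertices of \<open>X\<close> outside \<open>S\<close> would be twins, so some vertex
  of \<open>S\<close> would be adjacent to them. A neighbor of a 0-vertex is a 1 to its right, which
  \<open>uncovered\<close> excludes from \<open>S\<close>.\<close>

lemma card_zero_block_diff_le_1:
  assumes pds: "power_dominating_set (threshold_graph B) S" and X: "X \<in> zero_blocks B"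
    and uncovered: "\<And>s x. s \<in> S \<Longrightarrow> x \<in> X \<Longrightarrow> x < s \<Longrightarrow> \<not> B ! s"
  shows "card (X - S) \<le> 1"
proof (rule ccontr)
  assume "\<not> card (X - S) \<le> 1"
  then obtain p q where pq: "p \<in> X - S" "q \<in> X - S" "p \<noteq> q"
    \<comment> \<open>As \<open>card\<close> of an infinite set is 0, the negated bound also gives
      finiteness.\<close>
    by (metis One_nat_def card.empty card_le_Suc0_iff_eq card.infinite le0)
  have len: "p < length B" "q < length B"
    using X pq block_subset by (auto simp: zero_blocks_def)
  have zeros: "\<not> B ! r" if "p \<le> r \<and> r \<le> q \<or> q \<le> r \<and> r \<le> p" for r
    using that zero_block_convex[OF X] pq by blast
  have "p \<in> neighborhood (threshold_graph B) u \<longleftrightarrow> q \<in> neighborhood (threshold_graph B) u"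
    if "u \<noteq> p" "u \<noteq> q" for u
  proof -
    have "\<not> B ! p" "\<not> B ! q"
      using zeros[of p] zeros[of q] by linarith+
    \<comment> \<open>There is no 1 between \<open>p\<close> and \<open>q\<close>, so a 1 at
      \<open>u\<close> lies on the same side of both.\<close>
    moreover have "p < u \<longleftrightarrow> q < u" if "B ! u"
      using zeros[of u] that \<open>u \<noteq> p\<close> \<open>u \<noteq> q\<close> by linarith
    ultimately show ?thesis
      using len by (auto simp: mem_neighborhood_threshold_graph)
  qed
  then obtain u where "u \<in> S" "p \<in> neighborhood (threshold_graph B) u"
    using power_dominating_set_covers_twins[OF pds \<open>p \<noteq> q\<close>] pq len
    by (auto simp: pverts_threshold_graph)
  then show False
    using uncovered[of u p] zero_block_convex[OF X, of p p p] pq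
    by (auto simp: mem_neighborhood_threshold_graph)
qed

lemma criterion_if_power_dominating_set:
  assumes "length B \<ge> 2" and "B ! 0 = B ! 1"
    and pds: "power_dominating_set (threshold_graph B) S"
  shows "\<exists>v\<in>S. one_vertices B \<subseteq> closed_neighborhood (threshold_graph B) v \<and>
      (\<exists>Y\<in>blocks B. v \<in> Y \<and>
        (\<forall>X\<in>zero_blocks B. X = Y \<or> precedes Y X \<longrightarrow> card (X - S) \<le> 1))"
proof (cases "\<exists>s\<in>S. B ! s")
  case True
  have S: "S \<subseteq> {..<length B}"
    using pds by (simp add: power_dominating_set_def pverts_threshold_graph)
  then have fin: "finite {s \<in> S. B ! s}"
    using finite_subset[of S "{..<length B}"] by simp
  define v where "v = Max {s \<in> S. B ! s}"
  have v: "v \<in> S" "B ! v"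
    using Max_in[OF fin] True by (auto simp: v_def)
  have v_max: "s \<le> v" if "s \<in> S" "B ! s" for s
    using Max_ge[OF fin] that by (simp add: v_def)
  have "v < length B" using v S by auto
  then obtain Y where Y: "Y \<in> blocks B" "v \<in> Y" by (rule obtain_block)
  have "one_vertices B \<subseteq> closed_neighborhood (threshold_graph B) v"
    using v \<open>v < length B\<close>
    by (auto simp: one_vertices_eq closed_neighborhood_def mem_neighborhood_threshold_graph)
  moreover have "card (X - S) \<le> 1" if X: "X \<in> zero_blocks B" "X = Y \<or> precedes Y X" for X
  proof (rule card_zero_block_diff_le_1[OF pds X(1)])
    fix s x assume "s \<in> S" "x \<in> X" "x < s"
    \<comment> \<open>\<open>Y\<close> contains the 1 at \<open>v\<close>, so it is not a 0-block
      and only blocks after \<open>v\<close> matter.\<close>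
    have "X \<noteq> Y"
      using X Y v by (auto simp: zero_blocks_def all_zeros_def)
    then have "v < x"
      using X Y \<open>x \<in> X\<close> by (auto simp: precedes_def)
    then show "\<not> B ! s"
      using v_max[of s] \<open>s \<in> S\<close> \<open>x < s\<close> by auto
  qed
  ultimately show ?thesis using v(1) Y by blast
next
  case False
  have S: "S \<subseteq> {..<length B}"
    using pds by (simp add: power_dominating_set_def pverts_threshold_graph)
  have "\<exists>v\<in>S. \<forall>k<v. \<not> B ! k"
  proof (rule ccontr)
    assume "\<not> ?thesis"
    then have one_before: "\<exists>k<s. B ! k" if "s \<in> S" for s
      using that by blast
    have "0 \<notin> S"
      using one_before by blast
    \<comment> \<open>The only position before 1 is 0; a 1 there would make position 1 a 1-vertex
      too, and \<open>S\<close> contains none.\<close>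
    moreover have "1 \<notin> S"
      using one_before[of 1] False assms(2) by auto
    moreover have "0 \<in> neighborhood (threshold_graph B) u \<longleftrightarrow>
        1 \<in> neighborhood (threshold_graph B) u" if "u \<noteq> 0" "u \<noteq> 1" for u
      using that assms(1) by (auto simp: mem_neighborhood_threshold_graph)
    moreover have "0 \<in> pverts (threshold_graph B)"
      using assms(1) by (auto simp: pverts_threshold_graph)
    ultimately obtain u where "u \<in> S" "0 \<in> neighborhood (threshold_graph B) u"
      using power_dominating_set_covers_twins[OF pds, of 0 1] by (metis zero_neq_one)
    \<comment> \<open>A neighbor of position 0 has to be a 1.\<close>
    then show False
      using False by (auto simp: mem_neighborhood_threshold_graph)
  qed
  then obtain v where v: "v \<in> S" "\<And>k. k < v \<Longrightarrow> \<not> B ! k" by blast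
  have "v < length B" using v S by auto
  then obtain Y where Y: "Y \<in> blocks B" "v \<in> Y" by (rule obtain_block)
  have "one_vertices B \<subseteq> closed_neighborhood (threshold_graph B) v"
    using v \<open>v < length B\<close>
    by (auto simp: one_vertices_eq closed_neighborhood_def mem_neighborhood_threshold_graph)
      (meson nat_neq_iff)
  \<comment> \<open>Without 1-vertices in \<open>S\<close> the bound holds for every 0-block,
    wherever it lies relative to \<open>Y\<close>.\<close>
  moreover have "card (X - S) \<le> 1" if "X \<in> zero_blocks B" for X
    using card_zero_block_diff_le_1[OF pds that] False by blast
  ultimately show ?thesis using v(1) Y by blast
qed

theorem theorem22:
  fixes B :: "bool list" and L S :: "nat set"
  assumes "length B \<ge> 2"
    and "B ! 0 = B ! 1"
    and "last_block B L"
    and "L \<in> one_blocks B"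
    and "S \<subseteq> pverts (threshold_graph B)"
  shows "power_dominating_set (threshold_graph B) S \<longleftrightarrow>
    (\<exists>v\<in>S. one_vertices B \<subseteq> closed_neighborhood (threshold_graph B) v \<and>
      (\<exists>Y\<in>blocks B. v \<in> Y \<and>
        (\<forall>X\<in>zero_blocks B. X = Y \<or> precedes Y X \<longrightarrow> card (X - S) \<le> 1)))"
proof
  assume "power_dominating_set (threshold_graph B) S"
  with assms(1,2) show "\<exists>v\<in>S. one_vertices B \<subseteq> closed_neighborhood (threshold_graph B) v \<and>
      (\<exists>Y\<in>blocks B. v \<in> Y \<and>
        (\<forall>X\<in>zero_blocks B. X = Y \<or> precedes Y X \<longrightarrow> card (X - S) \<le> 1))"
    by (rule criterion_if_power_dominating_set)
next
  assume "\<exists>v\<in>S. one_vertices B \<subseteq> closed_neighborhood (threshold_graph B) v \<and>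
      (\<exists>Y\<in>blocks B. v \<in> Y \<and>
        (\<forall>X\<in>zero_blocks B. X = Y \<or> precedes Y X \<longrightarrow> card (X - S) \<le> 1))"
  then obtain v Y where "v \<in> S" "one_vertices B \<subseteq> closed_neighborhood (threshold_graph B) v"
      "Y \<in> blocks B" "v \<in> Y"
      "\<And>X. X \<in> zero_blocks B \<Longrightarrow> X = Y \<or> precedes Y X \<Longrightarrow> card (X - S) \<le> 1"
    by blast
  moreover have "S \<subseteq> {..<length B}"
    using assms(5) by (simp add: pverts_threshold_graph)
  ultimately show "power_dominating_set (threshold_graph B) S"
    using power_dominating_set_if_criterion last_symbol_if_last_block_ones[OF assms(3,4)]
    by blast
qed

end
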